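(* Every fermentable lattice is dually $*$-distributive.
   Context: Let $S$ be a join-semilattice (in particular, a lattice). Put $S^-=S\setminus\{0\}$ if $S$ has a zero (least) element, and $S^-=S$ otherwise. $\mathrm{J}(S)$ is the set of join-irreducible elements of $S$, i.e. elements of $S^-$ that are not the join of two strictly smaller elements. For $X\subseteq S$, $\downarrow X=\{y\in S\mid \exists x\in X,\ y\leq x\}$; $X$ refines $Y$, written $X\ll Y$, if $X\subseteq\downarrow Y$. For $a\in S^-$: - $\mathcal{C}(a)$ is the set of all finite $X\subseteq S$ with $a\notin\downarrow X$ and $a\leq\bigvee X$ (the nontrivial join-covers of $a$; they are necessarily nonempty); - $\mathcal{M}(a)$ is the set of all $E\in\mathcal{C}(a)$ such that for every $X\in\mathcal{C}(a)$, $X\ll E$ implies $E\subseteq X$; - for $\Sigma\subseteq S$, $\mathcal{M}_\Sigma(a)=\{E\in\mathcal{M}(a)\mid E\subseteq\Sigma\}$. For $\Sigma\subseteq\mathrm{J}(S)$, $S$ has the $\Sigma$-MCRP if for every $p\in\Sigma$, every element of $\mathcal{C}(p)$ is refined by some element of $\mathcal{M}_\Sigma(p)$, and $\mathcal{M}_\Sigma(p)$ is finite. The join-dependency relation $D$ on $\mathrm{J}(S)$: $a\mathbin{D}b$ iff $a\neq b$ and there is $c\in S$ such that $a\leq b\vee c$ but $a\nleq x\vee c$ for all $x<b$. An infinite $D$-sequence is a sequence $(a_n)_{n<\omega}$ in $\mathrm{J}(S)$ with $a_n\mathbin{D}a_{n+1}$ for all $n$. A subset $\Sigma\subseteq\mathrm{J}(S)$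 is a leaven of $S$ if: (1) $\Sigma$ join-generates $S$, i.e. every element of $S$ is a (possibly infinite or empty) join of elements of $\Sigma$; (2) $S$ satisfies the $\Sigma$-MCRP; (3) there is no infinite $D$-sequence of elements of $\Sigma$. $S$ is fermentable if it has a leaven. Dual $*$-distributivity. For a lattice $L$, let $L\cup\{1\}$ be $L$ with a new largest element $1$ added. For $a\in L$ and a finite sequence $\boldsymbol{s}$ of elements of $L$, define $a*\boldsymbol{s}\in L\cup\{1\}$ inductively by $a*\varnothing=1$ and $a*(\boldsymbol{s}^\frown\langle b\rangle)=a\vee(b\wedge(a*\boldsymbol{s}))$. For $B\subseteq L$ let $a*B$ be the set of all $a*\boldsymbol{s}$, for $\boldsymbol{s}$ a finite sequence of elements of $B$. $L$ is dually $*$-distributive if for all $a\in L$ and $B\subseteq L$ such that $\bigwedge B$ exists in $L$, the meet $\bigwedge(a*B)$ (greatest element of $L$ below all elements of $a*B$) exists and $\bigwedge(a*B)=a\vee\bigwedge B$. *)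

theory Defs
  imports "HOL-Library.Lub_Glb" "HOL-Library.Lattice_Constructions"
begin

text \<open>
  The ambient (join-semi)lattice is the whole carrier of a type of class
  \<^class>\<open>semilattice_sup\<close> or \<^class>\<open>lattice\<close>. No completeness and no existence of a least or
  greatest element is assumed, so infinite or empty joins and meets are expressed relationally
  by \<^term>\<open>isLub UNIV X x\<close> (``the join of X exists and equals x'') and \<^term>\<open>isGlb UNIV X x\<close>.
\<close>

definition S_minus :: "'a::order set" where
  "S_minus = {a. \<not> (\<forall>x. a \<le> x)}"

definition join_irreducibles :: "'a::semilattice_sup set" where
  "join_irreducibles = {p \<in> S_minus. \<not> (\<exists>x y. x < p \<and> y < p \<and> p = sup x y)}"

definition down :: "'a::order set \<Rightarrow> 'a set" where
  "down X = {y. \<exists>x\<in>X. y \<le> x}"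

definition refines :: "'a::order set \<Rightarrow> 'a set \<Rightarrow> bool" (infix \<open>\<lless>\<close> 50) where
  "X \<lless> Y \<longleftrightarrow> X \<subseteq> down Y"

text \<open>
  The following notions are meant for elements of \<^const>\<open>S_minus\<close>. There the empty set is never
  a cover: it has a join only if a zero exists, and then this join is zero.
\<close>

definition covers :: "'a::semilattice_sup \<Rightarrow> 'a set set" where
  "covers a = {X. finite X \<and> a \<notin> down X \<and> (\<exists>j. isLub UNIV X j \<and> a \<le> j)}"

definition min_covers :: "'a::semilattice_sup \<Rightarrow> 'a set set" where
  "min_covers a = {E \<in> covers a. \<forall>X\<in>covers a. X \<lless> E \<longrightarrow> E \<subseteq> X}"

definition min_covers_in :: "'a::semilattice_sup set \<Rightarrow> 'a \<Rightarrow> 'a set set" where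
  "min_covers_in \<Sigma> a = {E \<in> min_covers a. E \<subseteq> \<Sigma>}"

definition MCRP :: "'a::semilattice_sup set \<Rightarrow> bool" where
  "MCRP \<Sigma> \<longleftrightarrow>
     (\<forall>p\<in>\<Sigma>. (\<forall>X\<in>covers p. \<exists>E\<in>min_covers_in \<Sigma> p. E \<lless> X) \<and> finite (min_covers_in \<Sigma> p))"

definition join_dep :: "'a::semilattice_sup \<Rightarrow> 'a \<Rightarrow> bool" where
  "join_dep a b \<longleftrightarrow> a \<in> join_irreducibles \<and> b \<in> join_irreducibles \<and> a \<noteq> b \<and>
     (\<exists>c. a \<le> sup b c \<and> (\<forall>x. x < b \<longrightarrow> \<not> a \<le> sup x c))"

definition join_generates :: "'a::semilattice_sup set \<Rightarrow> bool" where
  "join_generates \<Sigma> \<longleftrightarrow> (\<forall>x. \<exists>X. X \<subseteq> \<Sigma> \<and> isLub UNIV X x)"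

definition leaven :: "'a::semilattice_sup set \<Rightarrow> bool" where
  "leaven \<Sigma> \<longleftrightarrow> \<Sigma> \<subseteq> join_irreducibles \<and> join_generates \<Sigma> \<and> MCRP \<Sigma> \<and>
     \<not> (\<exists>s :: nat \<Rightarrow> 'a. \<forall>n. s n \<in> \<Sigma> \<and> join_dep (s n) (s (Suc n)))"

text \<open>
  Being fermentable is a property of the structure on the type \<^typ>\<open>'a\<close>, which is passed
  as a type argument.
\<close>

definition fermentable :: "'a::semilattice_sup itself \<Rightarrow> bool" where
  "fermentable _ \<longleftrightarrow> (\<exists>\<Sigma> :: 'a set. leaven \<Sigma>)"

text \<open>
  The type \<^typ>\<open>'a top\<close> is the lattice with a new largest element \<^const>\<open>top.Top\<close> added, even if
  there already is a largest element. The recursion takes the last entry of the sequence first,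
  hence \<open>foldl\<close>; the two equations below are the intended ones.
\<close>

definition star :: "'a::lattice \<Rightarrow> 'a list \<Rightarrow> 'a top" where
  "star a s = foldl (\<lambda>t b. sup (top.Value a) (inf (top.Value b) t)) top.Top s"

lemma star_Nil: "star a [] = top.Top"
  by (simp add: star_def)

lemma star_snoc: "star a (s @ [b]) = sup (top.Value a) (inf (top.Value b) (star a s))"
  by (simp add: star_def)

definition star_set :: "'a::lattice \<Rightarrow> 'a set \<Rightarrow> 'a top set" where
  "star_set a B = {star a s | s. set s \<subseteq> B}"

text \<open>
  The meet of \<^term>\<open>star_set a B\<close> is its greatest lower bound among the elements of the original
  lattice, i.e. within \<^term>\<open>range top.Value\<close>. This matters if \<^term>\<open>B = {}\<close>, where
  \<^prop>\<open>star_set a B = {top.Top}\<close>.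
\<close>

definition dually_star_distributive :: "'a::lattice itself \<Rightarrow> bool" where
  "dually_star_distributive _ \<longleftrightarrow>
     (\<forall>(a::'a) B m. isGlb UNIV B m \<longrightarrow>
        isGlb (range top.Value) (star_set a B) (top.Value (sup a m)))"

end

theory Submission
  imports Defs
begin

text \<open>
  Suppose \<open>p \<in> \<Sigma>\<close> lies below every \<open>a * s\<close> but not below \<open>a\<close>, nor below some \<open>b \<in> B\<close>. Then each
  \<open>{a, b \<sqinter> (a * s)}\<close> is a nontrivial cover of \<open>p\<close>, hence is refined by a minimal cover in \<open>\<Sigma>\<close>.
  There are finitely many of these and \<open>a * (s @ t)\<close> lies below both \<open>a * s\<close> and \<open>a * t\<close>, so a
  single \<open>E\<close> refines all these covers. Every \<open>q \<in> E\<close> satisfies \<open>p D q\<close> and is below \<open>a\<close> or below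
  every \<open>a * s\<close>, so well-founded induction along \<open>D\<close> gives \<open>q \<le> a \<squnion> \<Sqinter>B\<close> for all \<open>q \<in> E\<close>, hence
  \<open>p \<le> a \<squnion> \<Sqinter>B\<close>.
\<close>

lemma isLub_UNIV_iff: "isLub UNIV X j \<longleftrightarrow> (\<forall>x\<in>X. x \<le> j) \<and> (\<forall>u. (\<forall>x\<in>X. x \<le> u) \<longrightarrow> j \<le> u)"
  by (auto simp: isLub_def leastP_def isUb_def setle_def setge_def)

lemma le_isLub:
  fixes p :: "'a::order"
  assumes "isLub UNIV X j" "p \<le> j" "\<And>x. x \<in> X \<Longrightarrow> x \<le> u"
  shows "p \<le> u"
  using assms unfolding isLub_UNIV_iff by (meson order_trans)

lemma isGlb_UNIV_iff: "isGlb UNIV X m \<longleftrightarrow> (\<forall>x\<in>X. m \<le> x) \<and> (\<forall>u. (\<forall>x\<in>X. u \<le> x) \<longrightarrow> u \<le> m)"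
  by (auto simp: isGlb_def greatestP_def isLb_def setle_def setge_def)

lemma isLub_Sup_fin:
  fixes X :: "'a::semilattice_sup set"
  assumes "finite X" "X \<noteq> {}"
  shows "isLub UNIV X (Sup_fin X)"
  using assms by (auto simp: isLub_UNIV_iff Sup_fin.bounded_iff intro: Sup_fin.coboundedI)

lemma isLub_doubleton: "isLub UNIV {x, y} (sup x y)" for x y :: "'a::semilattice_sup"
  by (auto simp: isLub_UNIV_iff)

lemma isLub_insert:
  fixes x c :: "'a::semilattice_sup"
  assumes "isLub UNIV X c"
  shows "isLub UNIV (insert x X) (sup x c)"
  using assms by (auto simp: isLub_UNIV_iff intro: le_supI2)

text \<open>The witness for \<open>join_dep\<close> is the join \<open>c\<close> of the other
  members of \<open>E\<close>. If some \<open>x < q\<close> could replace \<open>q\<close>, then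
  \<open>insert x (E - {q})\<close> would be a cover of \<open>p\<close> that refines
  \<open>E\<close> and misses \<open>q\<close>, against minimality.\<close>

lemma join_dep_min_cover:
  fixes p q :: "'a::semilattice_sup"
  assumes E: "E \<in> min_covers p" and q: "q \<in> E"
    and p_ji: "p \<in> join_irreducibles" and q_ji: "q \<in> join_irreducibles"
  shows "join_dep p q"
proof -
  from E obtain j where fin: "finite E" and nd: "p \<notin> down E" and j: "isLub UNIV E j" "p \<le> j"
    and min: "\<And>X. X \<in> covers p \<Longrightarrow> X \<lless> E \<Longrightarrow> E \<subseteq> X"
    by (auto simp: min_covers_def covers_def)
  have "\<not> p \<le> q" using nd q by (auto simp: down_def)
  \<comment> \<open>Without a zero the empty join does not exist, so \<open>c\<close> needs a
    nonempty set.\<close>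
  have "E - {q} \<noteq> {}"
  proof
    assume "E - {q} = {}"
    with q have "E = {q}" by blast
    with le_isLub[OF j, of q] \<open>\<not> p \<le> q\<close> show False by simp
  qed
  define c where "c = Sup_fin (E - {q})"
  have c: "isLub UNIV (E - {q}) c"
    unfolding c_def using fin \<open>E - {q} \<noteq> {}\<close> by (intro isLub_Sup_fin) auto
  have "isLub UNIV E (sup q c)"
    using isLub_insert[OF c, of q] q by (simp add: insert_absorb)
  with le_isLub[OF j, of "sup q c"] have "p \<le> sup q c"
    by (auto simp: isLub_UNIV_iff)
  moreover have "\<not> p \<le> sup x c" if "x < q" for x
  proof
    assume "p \<le> sup x c"
    have "\<not> p \<le> x" using \<open>\<not> p \<le> q\<close> that by (meson less_imp_le order_trans)
    with nd have "p \<notin> down (insert x (E - {q}))" by (auto simp: down_def)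
    with \<open>p \<le> sup x c\<close> fin isLub_insert[OF c, of x] have "insert x (E - {q}) \<in> covers p"
      by (auto simp: covers_def)
    moreover have "insert x (E - {q}) \<lless> E"
      using that q by (auto simp: refines_def down_def intro: less_imp_le)
    ultimately have "q \<in> insert x (E - {q})" using min q by blast
    with that show False by simp
  qed
  ultimately show ?thesis
    using p_ji q_ji \<open>\<not> p \<le> q\<close> by (auto simp: join_dep_def)
qed

lemma star_ge: "top.Value a \<le> star a s"
  by (cases s rule: rev_cases) (auto simp: star_Nil star_snoc)

lemma star_snoc_le: "star a (s @ [b]) \<le> star a s"
  by (simp add: star_snoc star_ge)

lemma star_append_le1: "star a (s @ t) \<le> star a s"
proof (induction t rule: rev_induct)
  case (snoc b t)
  have "star a (s @ t @ [b]) \<le> star a (s @ t)"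
    using star_snoc_le[of a "s @ t" b] by simp
  with snoc show ?case by (rule order_trans[rotated])
qed simp

text \<open>Prefixing \<open>s\<close> only lowers the starting value of the recursion from
  \<open>Top\<close> to \<open>star a s\<close>, and the recursion is monotone in that
  value.\<close>

lemma star_append_le2: "star a (s @ t) \<le> star a t"
proof (induction t rule: rev_induct)
  case Nil
  show ?case by (simp add: star_Nil)
next
  case (snoc b t)
  have "star a ((s @ t) @ [b]) \<le> star a (t @ [b])"
    unfolding star_snoc by (intro sup_mono inf_mono order_refl snoc)
  then show ?case by simp
qed

text \<open>Concatenating finitely many sequences gives a common lower bound. This makes one minimal
  cover serve all sequences in \<open>leaven_le\<close>.\<close>

lemma star_directed:
  assumes "finite F" "\<And>i. i \<in> F \<Longrightarrow> set (f i) \<subseteq> B"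
  shows "\<exists>u. set u \<subseteq> B \<and> (\<forall>i\<in>F. star a u \<le> star a (f i))"
  using assms
proof (induction F rule: finite_induct)
  case empty
  show ?case by (intro exI[of _ "[]"]) simp
next
  case (insert i F)
  then obtain u where u: "set u \<subseteq> B" "\<forall>k\<in>F. star a u \<le> star a (f k)" by auto
  have "set (u @ f i) \<subseteq> B" using u insert.prems by simp
  moreover have "star a (u @ f i) \<le> star a (f k)" if "k \<in> insert i F" for k
    using that u(2) star_append_le1[of a u "f i"] star_append_le2[of a u "f i"]
    by (metis insert_iff order_trans)
  ultimately show ?case by blast
qed

lemma leaven_le:
  fixes a m :: "'a::lattice"
  assumes \<Sigma>: "leaven \<Sigma>" and m: "isGlb UNIV B m"
    and p: "p \<in> \<Sigma>" and below: "\<And>s. set s \<subseteq> B \<Longrightarrow> top.Value p \<le> star a s"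
  shows "p \<le> sup a m"
proof -
  have ji: "\<Sigma> \<subseteq> join_irreducibles" and mcrp: "MCRP \<Sigma>"
    and no_seq: "\<not> (\<exists>s :: nat \<Rightarrow> 'a. \<forall>n. s n \<in> \<Sigma> \<and> join_dep (s n) (s (Suc n)))"
    using \<Sigma> by (auto simp: leaven_def)
  have "wf {(q, p). p \<in> \<Sigma> \<and> q \<in> \<Sigma> \<and> join_dep p q}"
    unfolding wf_iff_no_infinite_down_chain using no_seq by blast
  \<comment> \<open>Chaining in \<open>below\<close> makes it a premise of the induction hypothesis,
    to be re-established for each \<open>q\<close>.\<close>
  then show ?thesis using p below
  proof (induction p rule: wf_induct_rule)
    case (less p)
    show ?case
    proof (rule ccontr)
      assume not_le: "\<not> p \<le> sup a m"
      then have "\<not> p \<le> a" "\<not> p \<le> m" by (auto intro: le_supI1 le_supI2)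
      then obtain b where b: "b \<in> B" "\<not> p \<le> b" using m by (auto simp: isGlb_UNIV_iff)
      \<comment> \<open>\<open>R\<close> keeps the bound by \<open>star a s\<close> and forgets the
        one by \<open>b\<close>, so that \<open>R E s\<close> passes to every larger
        \<open>star a t\<close>.\<close>
      define R where "R E s \<longleftrightarrow> (\<forall>q\<in>E. q \<le> a \<or> top.Value q \<le> star a s)" for E s
      have ex: "\<exists>E\<in>min_covers_in \<Sigma> p. R E s" if s: "set s \<subseteq> B" for s
      proof -
        \<comment> \<open>A meet with \<open>Value b\<close> is never \<open>Top\<close>, so the
          cover can be formed in the original lattice.\<close>
        obtain v where v: "inf (top.Value b) (star a s) = top.Value v"
          by (cases "star a s") (auto simp: inf_top_def)
        have "v \<le> b" "top.Value v \<le> star a s"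
          using inf_le1[of "top.Value b" "star a s"] inf_le2[of "top.Value b" "star a s"]
          by (auto simp: v)
        have "p \<le> sup a v"
          using less.prems(2)[of "s @ [b]"] s b by (simp add: star_snoc v sup_top_def)
        moreover have "\<not> p \<le> v" using \<open>v \<le> b\<close> b by (meson order_trans)
        ultimately have "{a, v} \<in> covers p"
          using \<open>\<not> p \<le> a\<close> isLub_doubleton[of a v] by (auto simp: covers_def down_def)
        then obtain E where E: "E \<in> min_covers_in \<Sigma> p" "E \<lless> {a, v}"
          using mcrp less.prems(1) unfolding MCRP_def by blast
        have "R E s"
          unfolding R_def
        proof
          fix q assume "q \<in> E"
          with E have "q \<le> a \<or> q \<le> v" by (auto simp: refines_def down_def)
          moreover have "top.Value q \<le> star a s" if "q \<le> v"
            using that \<open>top.Value v \<le> star a s\<close> by (meson less_eq_top_Value_Value order_trans)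
          ultimately show "q \<le> a \<or> top.Value q \<le> star a s" by blast
        qed
        with E show ?thesis by blast
      qed
      have "\<exists>E\<in>min_covers_in \<Sigma> p. \<forall>s. set s \<subseteq> B \<longrightarrow> R E s"
      proof (rule ccontr)
        \<comment> \<open>If each of the finitely many \<open>E\<close> failed at some
          \<open>f E\<close>, a common lower bound \<open>star a u\<close> would make all of them
          fail at \<open>u\<close>, contradicting \<open>ex\<close>.\<close>
        assume "\<not> ?thesis"
        then obtain f where f: "\<And>E. E \<in> min_covers_in \<Sigma> p \<Longrightarrow> set (f E) \<subseteq> B \<and> \<not> R E (f E)"
          by metis
        have "finite (min_covers_in \<Sigma> p)" using mcrp less.prems(1) by (auto simp: MCRP_def)
        from star_directed[OF this, of f B a] f obtain u where
          u: "set u \<subseteq> B" "\<And>E. E \<in> min_covers_in \<Sigma> p \<Longrightarrow> star a u \<le> star a (f E)" by blast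
        from ex[OF u(1)] obtain E where E: "E \<in> min_covers_in \<Sigma> p" "R E u" by blast
        then have "R E (f E)" unfolding R_def using u(2)[OF E(1)] by (meson order_trans)
        with f E show False by blast
      qed
      then obtain E where E: "E \<in> min_covers p" "E \<subseteq> \<Sigma>"
        and R: "\<And>s. set s \<subseteq> B \<Longrightarrow> R E s" by (auto simp: min_covers_in_def)
      have "q \<le> sup a m" if "q \<in> E" for q
      proof (cases "q \<le> a")
        case False
        have "join_dep p q"
          using join_dep_min_cover[OF E(1) that] ji less.prems(1) E(2) that by blast
        moreover have "top.Value q \<le> star a s" if "set s \<subseteq> B" for s
          using R[OF that] \<open>q \<in> E\<close> False by (auto simp: R_def)
        ultimately show ?thesis using less.IH[of q] less.prems(1) E(2) that by blast
      qed (rule le_supI1)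
      moreover obtain j where "isLub UNIV E j" "p \<le> j"
        using E(1) by (auto simp: min_covers_def covers_def)
      ultimately have "p \<le> sup a m" by (blast intro: le_isLub)
      with not_le show False ..
    qed
  qed
qed

text \<open>In the inductive step \<open>m\<close> lies below both \<open>b\<close> and
  \<open>star a s\<close>, so it survives the meet of the two.\<close>

lemma star_ge_sup_lower_bound:
  assumes "\<And>b. b \<in> B \<Longrightarrow> m \<le> b" "set s \<subseteq> B"
  shows "top.Value (sup a m) \<le> star a s"
  using assms(2)
proof (induction s rule: rev_induct)
  case Nil
  show ?case by (simp add: star_Nil)
next
  case (snoc b s)
  have "top.Value m \<le> top.Value (sup a m)" by simp
  also have "\<dots> \<le> star a s" using snoc by simp
  finally have "top.Value m \<le> star a s" .
  moreover have "top.Value m \<le> top.Value b"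
    using snoc.prems assms(1) by (simp)
  ultimately have "sup (top.Value a) (top.Value m) \<le> star a (s @ [b])"
    unfolding star_snoc by (intro sup_mono order_refl le_infI)
  then show ?case by (simp add: sup_top_def)
qed

theorem corollary7p4:
  assumes "fermentable TYPE('a::lattice)"
  shows "dually_star_distributive TYPE('a)"
  unfolding dually_star_distributive_def
proof (intro allI impI)
  fix a m :: 'a and B
  assume m: "isGlb UNIV B m"
  obtain \<Sigma> :: "'a set" where \<Sigma>: "leaven \<Sigma>"
    using assms by (auto simp: fermentable_def)
  have "top.Value (sup a m) \<le> star a s" if "set s \<subseteq> B" for s
    using star_ge_sup_lower_bound[OF _ that] m by (auto simp: isGlb_UNIV_iff)
  moreover have "x \<le> sup a m" if x: "\<And>s. set s \<subseteq> B \<Longrightarrow> top.Value x \<le> star a s" for x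
  proof -
    \<comment> \<open>An arbitrary lower bound \<open>x\<close> is a join of elements of
      \<open>\<Sigma>\<close>, each of which inherits the bounds on \<open>x\<close> and falls under
      \<open>leaven_le\<close>.\<close>
    obtain X where X: "X \<subseteq> \<Sigma>" "isLub UNIV X x"
      using \<Sigma> unfolding leaven_def join_generates_def by blast
    have "p \<le> sup a m" if "p \<in> X" for p
    proof (rule leaven_le[OF \<Sigma> m])
      show "p \<in> \<Sigma>" using X that by blast
      fix s assume "set s \<subseteq> B"
      have "p \<le> x" using X that by (auto simp: isLub_UNIV_iff)
      then have "top.Value p \<le> top.Value x" by (simp)
      also have "\<dots> \<le> star a s" by (rule x) fact
      finally show "top.Value p \<le> star a s" .
    qed
    with X show ?thesis by (auto simp: isLub_UNIV_iff)
  qed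
  ultimately show "isGlb (range top.Value) (star_set a B) (top.Value (sup a m))"
    unfolding isGlb_def greatestP_def isLb_def setle_def setge_def star_set_def by fastforce
qed

end
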